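(* Let $1\le k\le n-1$ and let $w\in\mathfrak{S}_n$ be the permutation $(w(1),\dots,w(n))=(n-k+1,\dots,n,1,\dots,n-k)$, the maximal element of the set of minimal left coset representatives of $\mathfrak{S}_n$ modulo the parabolic subgroup generated by $\{s_1,\dots,s_{n-1}\}\setminus\{s_k\}$. Then the number of elements of the Bruhat interval $[\mathrm{id},w]$ is \[|[\mathrm{id},w]|=\sum_{i=0}^{k}S_{k+1,i+1}\,S_{n-k+1,i+1}\,(i!)^2=(-1)^k\sum_{i=0}^{k}(-1)^i(i+1)^{n-k}\,i!\,S_{k,i}=B_k^{(k-n)},\] where $S_{a,b}$ are the Stirling numbers of the second kind and $B_m^{(j)}$ are Kaneko's poly-Bernoulli numbers.
   Context: $s_i$ denotes the adjacent transposition $(i\ i{+}1)$ in $\mathfrak{S}_n$, and Bruhat order is the usual one. $S_{a,b}$ is the Stirling number of the second kind (with $S_{0,0}=1$, $S_{a,0}=0$ for $a>0$). For an integer $j$, the poly-Bernoulli numbers $B_m^{(j)}$ ($m\ge0$) of Kaneko are defined by $\sum_{m\ge0}B_m^{(j)}\frac{x^m}{m!}=\frac{\mathrm{Li}_j(1-e^{-x})}{1-e^{-x}}$, where $\mathrm{Li}_j(z)=\sum_{r\ge1}z^r/r^j$. *)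

theory Defs
  imports
    "HOL-Algebra.Sym_Groups"
    "HOL-Combinatorics.Stirling"
    "HOL-Computational_Algebra.Formal_Power_Series"
begin

(* The Coxeter length of a permutation of {1..n} is its number of inversions. *)
definition perm_length :: "nat \<Rightarrow> (nat \<Rightarrow> nat) \<Rightarrow> nat" where
  "perm_length n u = card {(i, j). 1 \<le> i \<and> i < j \<and> j \<le> n \<and> u i > u j}"

definition bruhat_step :: "nat \<Rightarrow> (nat \<Rightarrow> nat) \<Rightarrow> (nat \<Rightarrow> nat) \<Rightarrow> bool" where
  "bruhat_step n u v \<longleftrightarrow>
     u \<in> carrier (sym_group n) \<and>
     (\<exists>a b. 1 \<le> a \<and> a < b \<and> b \<le> n \<and> v = u \<otimes>\<^bsub>sym_group n\<^esub> transpose a b) \<and>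
     perm_length n u < perm_length n v"

definition bruhat_le :: "nat \<Rightarrow> (nat \<Rightarrow> nat) \<Rightarrow> (nat \<Rightarrow> nat) \<Rightarrow> bool" where
  "bruhat_le n = (bruhat_step n)\<^sup>*\<^sup>*"

definition bruhat_interval :: "nat \<Rightarrow> (nat \<Rightarrow> nat) \<Rightarrow> (nat \<Rightarrow> nat) \<Rightarrow> (nat \<Rightarrow> nat) set" where
  "bruhat_interval n u v = {x \<in> carrier (sym_group n). bruhat_le n u x \<and> bruhat_le n x v}"

definition adj_transp :: "nat \<Rightarrow> nat \<Rightarrow> nat" where
  "adj_transp i = transpose i (i + 1)"

definition parabolic :: "nat \<Rightarrow> nat set \<Rightarrow> (nat \<Rightarrow> nat) set" where
  "parabolic n J = generate (sym_group n) (adj_transp ` J)"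

(* The elements v of minimal length in their left coset v W_J. *)
definition min_left_coset_reps :: "nat \<Rightarrow> nat set \<Rightarrow> (nat \<Rightarrow> nat) set" where
  "min_left_coset_reps n J =
     {v \<in> carrier (sym_group n).
        \<forall>u \<in> v <#\<^bsub>sym_group n\<^esub> parabolic n J. perm_length n v \<le> perm_length n u}"

definition fps_Li :: "int \<Rightarrow> rat fps" where
  "fps_Li j = Abs_fps (\<lambda>r. if r = 0 then 0 else 1 / (of_nat r powi j))"

(* The divisor has zero constant term; the quotient is nevertheless the exact one, because the
   composition in the numerator is a multiple of the divisor. *)
definition poly_bernoulli :: "int \<Rightarrow> nat \<Rightarrow> rat" where
  "poly_bernoulli j m =
     fact m * fps_nth ((fps_Li j oo (1 - fps_exp (-1))) / (1 - fps_exp (-1))) m"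

end

theory Submission
  imports Defs
begin

text \<open>The interval below \<open>w\<close> consists of the permutations \<open>u\<close> with \<open>i - k \<le> u i \<le> i + n - k\<close>:
  this condition is inherited by smaller elements, and any \<open>u \<noteq> w\<close> satisfying it can be raised by a
  transposition without violating it. Cut the permutation matrix of such a \<open>u\<close> after row \<open>k\<close> and
  column \<open>n - k\<close>. The condition only restricts the upper right and the lower left block, both to
  staircases, in which rook placements are counted by Stirling numbers. If such placements leave
  \<open>i\<close> rows of the upper half free, they can be completed in the two unrestricted blocks
  in \<open>(i!)\<^sup>2\<close> ways.\<close>

subsection \<open>Stirling numbers and poly-Bernoulli numbers\<close>

lemma power_eq_sum_Stirling_binomial:
  "x ^ n = (\<Sum>j\<le>n. Stirling n j * fact j * (x choose j))"
proof (induction n)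
  case (Suc n)
  let ?coeff = "\<lambda>j. Stirling n j * fact j"
  have absorb: "x * (x choose j) = j * (x choose j) + Suc j * (x choose Suc j)" for j
  proof (cases "j \<le> x")
    case True
    then have "x * (x choose j) = j * (x choose j) + (x - j) * (x choose j)"
      by (simp flip: distrib_right)
    then show ?thesis by (simp only: binomial_absorb_comp binomial_absorption)
  qed (simp add: binomial_eq_0)
  have "x ^ Suc n = (\<Sum>j\<le>n. ?coeff j * (x * (x choose j)))"
    by (simp add: Suc.IH sum_distrib_left mult_ac)
  also have "\<dots> = (\<Sum>j\<le>n. j * ?coeff j * (x choose j)) + (\<Sum>j\<le>n. Suc j * ?coeff j * (x choose Suc j))"
    unfolding absorb sum.distrib[symmetric] by (simp add: algebra_simps)
  also have "(\<Sum>j\<le>n. j * ?coeff j * (x choose j)) =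
      (\<Sum>j\<le>n. Suc j * ?coeff (Suc j) * (x choose Suc j))"
    using sum.atMost_Suc_shift[of "\<lambda>j. j * ?coeff j * (x choose j)" n] by simp
  also have "\<dots> + (\<Sum>j\<le>n. Suc j * ?coeff j * (x choose Suc j)) =
      (\<Sum>j\<le>n. Stirling (Suc n) (Suc j) * fact (Suc j) * (x choose Suc j))"
    unfolding sum.distrib[symmetric] by (simp add: algebra_simps)
  also have "\<dots> = (\<Sum>j\<le>Suc n. Stirling (Suc n) j * fact j * (x choose j))"
    by (simp add: sum.atMost_Suc_shift del: sum.atMost_Suc)
  finally show ?case .
qed simp

lemma power_Suc_eq_sum_Stirling_binomial:
  "(x + 1) ^ n = (\<Sum>j\<le>n. Stirling (n + 1) (j + 1) * fact j * (x choose j))"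
proof -
  have "(x + 1) * (x + 1) ^ n =
      (\<Sum>j\<le>n. Stirling (n + 1) (j + 1) * fact j * (Suc j * (Suc x choose Suc j)))"
    using power_eq_sum_Stirling_binomial[of "x + 1" "n + 1"]
    by (simp add: sum.atMost_Suc_shift mult.assoc mult.left_commute[of "fact _"]
        del: sum.atMost_Suc Stirling.simps(4) binomial_Suc_Suc mult_Suc mult_Suc_right)
  also have "\<dots> = (x + 1) * (\<Sum>j\<le>n. Stirling (n + 1) (j + 1) * fact j * (x choose j))"
    unfolding sum_distrib_left
  proof (rule sum.cong)
    fix j
    have "Suc j * (Suc x choose Suc j) = (x + 1) * (x choose j)"
      using Suc_times_binomial_eq[of x j] by (simp only: mult_ac Suc_eq_plus1)
    then show "Stirling (n + 1) (j + 1) * fact j * (Suc j * (Suc x choose Suc j)) =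
        (x + 1) * (Stirling (n + 1) (j + 1) * fact j * (x choose j))"
      by (simp only: mult_ac)
  qed simp
  finally show ?thesis by (rule mult_left_cancel[THEN iffD1, rotated]) simp
qed

lemma alternating_sum_Stirling_Suc:
  fixes f :: "nat \<Rightarrow> 'a :: {comm_ring_1, ring_char_0}"
  shows "(\<Sum>i\<le>Suc k. (-1) ^ (Suc k + i) * fact i * of_nat (Stirling (Suc k) i) * f i) =
    (\<Sum>i\<le>k. (-1) ^ (k + i) * fact i * of_nat (Stirling k i) *
      (of_nat (Suc i) * f (Suc i) - of_nat i * f i))"
proof -
  define coeff :: "nat \<Rightarrow> 'a" where "coeff i = (-1) ^ (k + i) * fact i * of_nat (Stirling k i)" for i
  let ?g = "\<lambda>i. coeff i * (of_nat i * f i)"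
  have "(-1) ^ (Suc k + Suc i) * fact (Suc i) * of_nat (Stirling (Suc k) (Suc i)) * f (Suc i) =
      coeff i * (of_nat (Suc i) * f (Suc i)) - ?g (Suc i)" for i
    by (simp add: coeff_def algebra_simps)
  then have "(\<Sum>i\<le>Suc k. (-1) ^ (Suc k + i) * fact i * of_nat (Stirling (Suc k) i) * f i) =
      (\<Sum>i\<le>k. coeff i * (of_nat (Suc i) * f (Suc i)) - ?g (Suc i))"
    by (subst sum.atMost_Suc_shift) simp
  moreover have "(\<Sum>i\<le>k. ?g (Suc i)) = (\<Sum>i\<le>k. ?g i)"
    using sum.atMost_Suc_shift[of ?g k] by (simp add: coeff_def)
  ultimately show ?thesis by (simp only: sum_subtractf right_diff_distrib coeff_def)
qed

lemma alternating_sum_Stirling_binomial: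
  "(\<Sum>i\<le>k. (-1) ^ (k + i) * fact i * int (Stirling k i) * int (i choose j)) =
     fact j * int (Stirling (k + 1) (j + 1))"
proof (induction k arbitrary: j)
  case 0
  show ?case by (cases j) simp_all
next
  case (Suc k)
  let ?A = "\<lambda>j. \<Sum>i\<le>k. (-1) ^ (k + i) * fact i * int (Stirling k i) * int (i choose j)"
  have binomial_diff: "int (Suc i) * int (Suc i choose j) - int i * int (i choose j) =
      int (j + 1) * int (i choose j) + int j * int (i choose (j - 1))" for i
  proof (cases j)
    case (Suc l)
    then show ?thesis
      using arg_cong[OF Suc_times_binomial_eq[of i l], of int] by (simp add: algebra_simps)
  qed simp
  have "(\<Sum>i\<le>Suc k. (-1) ^ (Suc k + i) * fact i * int (Stirling (Suc k) i) * int (i choose j)) =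
      int (j + 1) * ?A j + int j * ?A (j - 1)"
    unfolding alternating_sum_Stirling_Suc binomial_diff sum_distrib_left sum.distrib[symmetric]
    by (simp only: distrib_left mult_ac)
  also have "\<dots> = fact j * int (Stirling (Suc k + 1) (j + 1))"
    unfolding Suc.IH by (cases j) (simp_all add: algebra_simps)
  finally show ?case .
qed

lemma Stirling_sum_eq_alternating_sum:
  "int (\<Sum>i = 0..k. Stirling (k + 1) (i + 1) * Stirling (m + 1) (i + 1) * (fact i)\<^sup>2) =
     (-1) ^ k * (\<Sum>i = 0..k. (-1) ^ i * (int i + 1) ^ m * fact i * int (Stirling k i))"
proof -
  let ?g = "\<lambda>j. int (Stirling (m + 1) (j + 1)) * fact j"
  have power_expansion: "(int i + 1) ^ m = (\<Sum>j\<le>m. ?g j * int (i choose j))" for i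
    using arg_cong[OF power_Suc_eq_sum_Stirling_binomial[of i m], of int] by (simp add: add.commute)
  have "(-1) ^ k * (\<Sum>i = 0..k. (-1) ^ i * (int i + 1) ^ m * fact i * int (Stirling k i)) =
      (\<Sum>i\<le>k. \<Sum>j\<le>m. ?g j * ((-1) ^ (k + i) * fact i * int (Stirling k i) * int (i choose j)))"
    unfolding power_expansion atMost_atLeast0
    by (simp add: sum_distrib_left sum_distrib_right power_add mult_ac)
  also have "\<dots> = (\<Sum>j\<le>m. ?g j * (fact j * int (Stirling (k + 1) (j + 1))))"
    by (subst sum.swap) (simp only: sum_distrib_left[symmetric] alternating_sum_Stirling_binomial)
  also have "\<dots> = (\<Sum>j\<le>max k m. ?g j * (fact j * int (Stirling (k + 1) (j + 1))))"
    by (rule sum.mono_neutral_left) auto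
  also have "\<dots> = (\<Sum>j\<le>k. ?g j * (fact j * int (Stirling (k + 1) (j + 1))))"
    by (rule sum.mono_neutral_right) auto
  finally show ?thesis
    by (simp add: atMost_atLeast0 power2_eq_square mult_ac)
qed

lemma fact_mult_fps_nth_power_one_minus_exp:
  "fact k * fps_nth ((1 - fps_exp (-1)) ^ r) k =
     ((-1) ^ (k + r) * fact r * of_nat (Stirling k r) :: 'a :: field_char_0)"
proof (induction k arbitrary: r)
  case 0
  show ?case by (cases r) simp_all
next
  case (Suc k)
  let ?g = "1 - fps_exp (-1) :: 'a fps"
  show ?case
  proof (cases r)
    case (Suc s)
    have "fps_deriv ?g = 1 - ?g"
      by (simp flip: fps_const_neg)
    then have "fps_deriv (?g ^ Suc s) = fps_const (of_nat (Suc s)) * (?g ^ s - ?g ^ Suc s)"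
      by (simp only: fps_deriv_power) (simp add: algebra_simps)
    then have "fps_nth (fps_deriv (?g ^ Suc s)) k =
        of_nat (Suc s) * (fps_nth (?g ^ s) k - fps_nth (?g ^ Suc s) k)"
      by (simp only: fps_mult_left_const_nth fps_sub_nth)
    then have "fact (Suc k) * fps_nth (?g ^ Suc s) (Suc k) =
        of_nat (Suc s) * (fact k * fps_nth (?g ^ s) k - fact k * fps_nth (?g ^ Suc s) k)"
      unfolding fps_deriv_nth fact_Suc by (simp only: Suc_eq_plus1 right_diff_distrib' mult_ac)
    also have "\<dots> = (-1) ^ (Suc k + Suc s) * fact (Suc s) * of_nat (Stirling (Suc k) (Suc s))"
      unfolding Suc.IH by (simp add: algebra_simps)
    finally show ?thesis using Suc by simp
  qed simp
qed

lemma poly_bernoulli_neg_eq: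
  "poly_bernoulli (- int m) k =
     of_int ((-1) ^ k * (\<Sum>i = 0..k. (-1) ^ i * (int i + 1) ^ m * fact i * int (Stirling k i)))"
proof -
  let ?g = "1 - fps_exp (-1) :: rat fps"
  define G :: "rat fps" where "G = Abs_fps (\<lambda>r. (of_nat r + 1) ^ m)"
  have fps_Li_eq: "fps_Li (- int m) = fps_X * G"
    by (rule fps_ext) (auto simp: fps_Li_def G_def power_int_minus divide_simps)
  have "?g \<noteq> 0"
  proof
    assume "?g = 0"
    then have "fps_nth ?g 1 = 0" by simp
    then show False by simp
  qed
  moreover have "fps_Li (- int m) oo ?g = ?g * (G oo ?g)"
    unfolding fps_Li_eq by (subst fps_compose_mult_distrib) simp_all
  ultimately have "(fps_Li (- int m) oo ?g) / ?g = G oo ?g" by simp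
  then have "poly_bernoulli (- int m) k =
      (\<Sum>i = 0..k. (of_nat i + 1) ^ m * (fact k * fps_nth (?g ^ i) k))"
    by (simp add: poly_bernoulli_def fps_compose_nth G_def sum_distrib_left mult_ac)
  then show ?thesis
    unfolding fact_mult_fps_nth_power_one_minus_exp
    by (simp add: sum_distrib_left power_add mult_ac)
qed

subsection \<open>Rook placements\<close>

definition rook_placements :: "('a \<times> 'b) set \<Rightarrow> ('a \<times> 'b) set set" where
  "rook_placements X = {M. M \<subseteq> X \<and> inj_on fst M \<and> inj_on snd M}"

definition rook_number :: "('a \<times> 'b) set \<Rightarrow> nat \<Rightarrow> nat" where
  "rook_number X j = card {M \<in> rook_placements X. card M = j}"

lemma finite_rook_placements: "finite X \<Longrightarrow> finite (rook_placements X)"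
  by (rule finite_subset[of _ "Pow X"]) (auto simp: rook_placements_def)

lemma finite_rook_placement: "finite X \<Longrightarrow> M \<in> rook_placements X \<Longrightarrow> finite M"
  by (auto simp: rook_placements_def intro: finite_subset)

lemma card_rook_placement_le:
  "M \<in> rook_placements X \<Longrightarrow> fst ` X \<subseteq> A \<Longrightarrow> finite A \<Longrightarrow> card M \<le> card A"
  by (rule card_inj_on_le[of fst]) (auto simp: rook_placements_def)

lemma card_Diff_fst_rook_placement:
  assumes "M \<in> rook_placements X" "fst ` X \<subseteq> A" "finite A"
  shows "card (A - fst ` M) = card A - card M"
proof -
  have "fst ` M \<subseteq> A" "card (fst ` M) = card M"
    using assms by (auto simp: rook_placements_def card_image)
  then show ?thesis using assms(3) by (simp add: card_Diff_subset finite_subset)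
qed

lemma card_Diff_snd_rook_placement:
  assumes "M \<in> rook_placements X" "snd ` X \<subseteq> B" "finite B"
  shows "card (B - snd ` M) = card B - card M"
proof -
  have "snd ` M \<subseteq> B" "card (snd ` M) = card M"
    using assms by (auto simp: rook_placements_def card_image)
  then show ?thesis using assms(3) by (simp add: card_Diff_subset finite_subset)
qed

lemma rook_number_0 [simp]: "finite X \<Longrightarrow> rook_number X 0 = 1"
proof -
  assume "finite X"
  then have "{M \<in> rook_placements X. card M = 0} = {{}}"
    using finite_rook_placement[of X] by (auto simp: rook_placements_def)
  then show ?thesis by (simp add: rook_number_def)
qed

lemma rook_number_empty_Suc [simp]: "rook_number {} (Suc j) = 0"
  by (simp add: rook_number_def rook_placements_def)

lemma rook_number_converse: "rook_number (X\<inverse>) j = rook_number X j"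
proof -
  have inj_converse: "inj_on fst (M\<inverse>) \<longleftrightarrow> inj_on snd M" "inj_on snd (M\<inverse>) \<longleftrightarrow> inj_on fst M"
    for M :: "('c \<times> 'd) set"
    unfolding inj_on_def Ball_def split_paired_All by auto
  have "bij_betw converse {M \<in> rook_placements X. card M = j}
      {M \<in> rook_placements (X\<inverse>). card M = j}"
    by (rule bij_betw_byWitness[where f' = converse]) (auto simp: rook_placements_def inj_converse)
  then show ?thesis unfolding rook_number_def by (simp add: bij_betw_same_card)
qed

lemma rook_placements_Un_row:
  assumes "a \<notin> fst ` X"
  shows "rook_placements (X \<union> {a} \<times> C) =
    rook_placements X \<union> (\<lambda>(M, c). insert (a, c) M) ` (SIGMA M:rook_placements X. C - snd ` M)"
    (is "_ = _ \<union> ?f ` ?D")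
proof (intro equalityI subsetI)
  fix M assume M: "M \<in> rook_placements (X \<union> {a} \<times> C)"
  show "M \<in> rook_placements X \<union> ?f ` ?D"
  proof (cases "\<exists>c. (a, c) \<in> M")
    case False
    then show ?thesis using M by (auto simp: rook_placements_def)
  next
    case True
    then obtain c where c: "(a, c) \<in> M" by blast
    define N where "N = M - {(a, c)}"
    have "(a, c) \<notin> X" using assms by force
    have M_eq: "M = insert (a, c) N" and "(a, c) \<notin> N" using c by (auto simp: N_def)
    then have "c \<in> C" "N \<subseteq> X \<union> {a} \<times> C" "inj_on fst N" "inj_on snd N" "a \<notin> fst ` N" "c \<notin> snd ` N"
      using M \<open>(a, c) \<notin> X\<close> by (auto simp: rook_placements_def inj_on_insert)
    moreover from this have "N \<subseteq> X" by force
    ultimately have "(N, c) \<in> ?D" by (simp add: rook_placements_def)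
    then show ?thesis using M_eq by blast
  qed
next
  fix M assume "M \<in> rook_placements X \<union> ?f ` ?D"
  then consider "M \<in> rook_placements X"
    | N c where "M = insert (a, c) N" "N \<in> rook_placements X" "c \<in> C" "c \<notin> snd ` N"
    by auto
  then show "M \<in> rook_placements (X \<union> {a} \<times> C)"
  proof cases
    case 2
    moreover have "a \<notin> fst ` N" using 2(2) assms by (auto simp: rook_placements_def)
    ultimately show ?thesis by (auto simp: rook_placements_def inj_on_insert)
  qed (auto simp: rook_placements_def)
qed

lemma rook_number_Un_row:
  assumes new: "a \<notin> fst ` X" and cols: "snd ` X \<subseteq> C" and fin: "finite X" "finite C"
  shows "rook_number (X \<union> {a} \<times> C) (Suc j) = rook_number X (Suc j) + (card C - j) * rook_number X j"
proof -
  let ?R = "\<lambda>j. {M \<in> rook_placements X. card M = j}"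
  let ?D = "SIGMA M:?R j. C - snd ` M" and ?f = "\<lambda>(M, c). insert (a, c) M"
  have fresh: "(a, c) \<notin> M" if "M \<in> rook_placements X" for M c
    using that new by (force simp: rook_placements_def)
  have fin_R: "finite (?R i)" for i using finite_rook_placements[OF fin(1)] by simp
  have "{M \<in> rook_placements (X \<union> {a} \<times> C). card M = Suc j} = ?R (Suc j) \<union> ?f ` ?D"
    unfolding rook_placements_Un_row[OF new] using fresh finite_rook_placement[OF fin(1)] by auto
  moreover have "?R (Suc j) \<inter> ?f ` ?D = {}" using fresh by auto
  ultimately have "rook_number (X \<union> {a} \<times> C) (Suc j) = rook_number X (Suc j) + card (?f ` ?D)"
    unfolding rook_number_def using fin_R fin by (simp add: card_Un_disjoint)
  also have "inj_on ?f ?D"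
  proof (rule inj_onI, clarify)
    fix M c N d
    assume M: "M \<in> rook_placements X" and N: "N \<in> rook_placements X"
      and eq: "insert (a, c) M = insert (a, d) N"
    then have "c = d" using fresh[OF N] by auto
    then show "M = N \<and> c = d" using eq insert_ident[OF fresh[OF M] fresh[OF N]] by simp
  qed
  then have "card (?f ` ?D) = card ?D" by (rule card_image)
  also have "card (C - snd ` M) = card C - j" if "M \<in> ?R j" for M
    using that cols fin by (auto simp: card_Diff_snd_rook_placement)
  then have "card ?D = (card C - j) * rook_number X j"
    using fin_R fin(2) by (simp add: card_SigmaI rook_number_def)
  finally show ?thesis .
qed

lemma sum_rook_placements_fun_diff_card:
  assumes fin: "finite X" and bound: "\<And>M. M \<in> rook_placements X \<Longrightarrow> card M \<le> k"
  shows "(\<Sum>M\<in>rook_placements X. f (k - card M)) = (\<Sum>i\<le>k. rook_number X (k - i) * f i)"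
proof -
  have "(\<Sum>M\<in>rook_placements X. f (k - card M)) =
      (\<Sum>i\<le>k. of_nat (card {M \<in> rook_placements X. k - card M = i}) * f i)"
    by (rule sum_fun_comp) (auto simp: finite_rook_placements fin)
  moreover have "{M \<in> rook_placements X. k - card M = i} = {M \<in> rook_placements X. card M = k - i}"
    if "i \<le> k" for i
    using bound that by force
  ultimately show ?thesis by (simp add: rook_number_def)
qed

lemma sum_rook_placements_equal_diff_card:
  assumes "finite X" "finite Y"
    and bound_X: "\<And>M. M \<in> rook_placements X \<Longrightarrow> card M \<le> k"
    and bound_Y: "\<And>N. N \<in> rook_placements Y \<Longrightarrow> card N \<le> m"
  shows "(\<Sum>M\<in>rook_placements X. \<Sum>N\<in>rook_placements Y.
      if k - card M = m - card N then f (k - card M) else 0) =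
    (\<Sum>i\<le>min k m. rook_number X (k - i) * rook_number Y (m - i) * f i)"
proof -
  define g where "g i j = (if i = j then f i else 0)" for i j
  have "(\<Sum>M\<in>rook_placements X. \<Sum>N\<in>rook_placements Y. g (k - card M) (m - card N)) =
      (\<Sum>M\<in>rook_placements X. \<Sum>j\<le>m. rook_number Y (m - j) * g (k - card M) j)"
    using \<open>finite Y\<close> bound_Y by (simp add: sum_rook_placements_fun_diff_card)
  also have "\<dots> = (\<Sum>i\<le>k. rook_number X (k - i) * (\<Sum>j\<le>m. rook_number Y (m - j) * g i j))"
    using \<open>finite X\<close> bound_X by (rule sum_rook_placements_fun_diff_card)
  also have "\<dots> = (\<Sum>i\<le>k. if i \<le> m then rook_number X (k - i) * rook_number Y (m - i) * f i else 0)"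
    by (intro sum.cong) (simp_all add: g_def if_distrib sum.delta cong: if_cong)
  also have "\<dots> = (\<Sum>i\<le>min k m. rook_number X (k - i) * rook_number Y (m - i) * f i)"
    by (rule sum.mono_neutral_cong_right) auto
  finally show ?thesis by (simp only: g_def)
qed

definition staircase :: "nat \<Rightarrow> nat \<Rightarrow> (nat \<times> nat) set" where
  "staircase s k = {(i, c). 1 \<le> i \<and> i \<le> k \<and> s < c \<and> c \<le> s + i}"

lemma finite_staircase: "finite (staircase s k)"
  by (rule finite_subset[of _ "{..k} \<times> {..s + k}"]) (auto simp: staircase_def)

lemma staircase_Suc: "staircase s (Suc k) = staircase s k \<union> {Suc k} \<times> {s<..s + Suc k}"
  by (auto simp: staircase_def le_Suc_eq)

lemma rook_number_staircase: "rook_number (staircase s k) j = Stirling (k + 1) (k + 1 - j)"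
proof (induction k arbitrary: j)
  case 0
  have "staircase s 0 = {}" by (auto simp: staircase_def)
  then show ?case by (cases j) simp_all
next
  case (Suc k)
  show ?case
  proof (cases j)
    case 0
    then show ?thesis by (simp add: finite_staircase)
  next
    case (Suc l)
    have "rook_number (staircase s (Suc k)) (Suc l) =
        rook_number (staircase s k) (Suc l) + (Suc k - l) * rook_number (staircase s k) l"
      unfolding staircase_Suc
      by (subst rook_number_Un_row) (use finite_staircase in \<open>auto simp: staircase_def\<close>)
    also have "\<dots> = Stirling (Suc k + 1) (Suc k + 1 - Suc l)"
    proof (cases "l \<le> k")
      case True
      then show ?thesis unfolding Suc.IH by (simp add: Suc_diff_le)
    qed (simp add: Suc.IH)
    finally show ?thesis using Suc by simp
  qed
qed

subsection \<open>Perfect matchings of a board\<close>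

definition perfect_matchings :: "('a \<times> 'b) set \<Rightarrow> 'a set \<Rightarrow> 'b set \<Rightarrow> ('a \<times> 'b) set set" where
  "perfect_matchings F A B = {M. M \<subseteq> F \<and> bij_betw fst M A \<and> bij_betw snd M B}"

lemma perfect_matchings_subset: "M \<in> perfect_matchings F A B \<Longrightarrow> M \<subseteq> F \<inter> A \<times> B"
  using subset_fst_snd[of M] by (auto simp: perfect_matchings_def bij_betw_def)

lemma perfect_matchings_Int: "perfect_matchings (F \<inter> A \<times> B) A B = perfect_matchings F A B"
  using perfect_matchings_subset[of _ F A B] by (auto simp: perfect_matchings_def)

lemma finite_perfect_matchings: "finite A \<Longrightarrow> finite B \<Longrightarrow> finite (perfect_matchings F A B)"
  by (rule finite_subset[of _ "Pow (A \<times> B)"]) (auto dest: perfect_matchings_subset)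

lemma perfect_matchings_Un:
  assumes "M \<in> perfect_matchings F A B" "N \<in> perfect_matchings G C D" "A \<inter> C = {}" "B \<inter> D = {}"
  shows "M \<union> N \<in> perfect_matchings (F \<union> G) (A \<union> C) (B \<union> D)"
  using assms by (auto simp: perfect_matchings_def intro: bij_betw_combine)

lemma perfect_matching_eq_graph:
  assumes "M \<in> perfect_matchings F A B"
  obtains f where "bij_betw f A B" "M = (\<lambda>a. (a, f a)) ` A"
proof
  let ?e = "inv_into M fst"
  have bij_fst: "bij_betw fst M A" and bij_snd: "bij_betw snd M B"
    using assms by (simp_all add: perfect_matchings_def)
  show "bij_betw (snd \<circ> ?e) A B"
    using bij_betw_trans[OF bij_betw_inv_into[OF bij_fst] bij_snd] .
  have "M = ?e ` A"
    using bij_betw_imp_surj_on[OF bij_betw_inv_into[OF bij_fst]] by simp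
  also have "\<dots> = (\<lambda>a. (a, (snd \<circ> ?e) a)) ` A"
    using bij_betw_inv_into_right[OF bij_fst] by (intro image_cong) (simp_all add: prod_eq_iff)
  finally show "M = (\<lambda>a. (a, (snd \<circ> ?e) a)) ` A" .
qed

lemma graph_mem_perfect_matchings_iff:
  assumes "bij_betw f A B"
  shows "(\<lambda>a. (a, f a)) ` A \<in> perfect_matchings F A B \<longleftrightarrow> (\<forall>a\<in>A. (a, f a) \<in> F)"
  using assms by (auto simp: perfect_matchings_def bij_betw_def inj_on_def image_image)

lemma bij_betw_graph_perfect_matchings:
  assumes h: "bij_betw h A B"
  shows "bij_betw (\<lambda>p. (\<lambda>a. (a, h (p a))) ` A) {p. p permutes A \<and> (\<forall>a\<in>A. (a, h (p a)) \<in> F)}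
    (perfect_matchings F A B)"
    (is "bij_betw ?graph ?P _")
proof (rule bij_betw_imageI)
  have comp_bij: "bij_betw (\<lambda>a. h (p a)) A B" if "p permutes A" for p
    using bij_betw_trans[OF permutes_imp_bij[OF that] h] by (simp add: o_def)
  show "inj_on ?graph ?P"
  proof (intro inj_onI ext, clarify)
    fix p q a
    assume p: "p permutes A" and q: "q permutes A" and graph_eq: "?graph p = ?graph q"
    show "p a = q a"
    proof (cases "a \<in> A")
      case True
      then have "h (p a) = h (q a)" using graph_eq by blast
      then show ?thesis
        using True p q bij_betw_imp_inj_on[OF h] by (simp add: inj_on_eq_iff permutes_in_image)
    qed (use p q in \<open>simp add: permutes_not_in\<close>)
  qed
  show "?graph ` ?P = perfect_matchings F A B"
  proof (intro equalityI subsetI)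
    fix M assume "M \<in> ?graph ` ?P"
    then show "M \<in> perfect_matchings F A B"
      using graph_mem_perfect_matchings_iff[OF comp_bij] by auto
  next
    fix M assume M: "M \<in> perfect_matchings F A B"
    then obtain f where f: "bij_betw f A B" and M_eq: "M = (\<lambda>a. (a, f a)) ` A"
      by (rule perfect_matching_eq_graph)
    define p where "p = restrict_id (inv_into A h \<circ> f) A"
    have "p permutes A"
      unfolding p_def using bij_betw_trans[OF f bij_betw_inv_into[OF h]]
      by (rule permutes_restrict_id)
    moreover have graph_p: "h (p a) = f a" if "a \<in> A" for a
      using that h f by (simp add: p_def bij_betw_inv_into_right bij_betw_apply)
    then have "M = ?graph p" unfolding M_eq by simp
    moreover have "\<forall>a\<in>A. (a, h (p a)) \<in> F"
      using M graph_p graph_mem_perfect_matchings_iff[OF f, of F] unfolding M_eq by simp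
    ultimately show "M \<in> ?graph ` ?P" by blast
  qed
qed

lemma card_permutations_in_board:
  "card {p. p permutes A \<and> (\<forall>a\<in>A. (a, p a) \<in> F)} = card (perfect_matchings F A A)"
  using bij_betw_same_card[OF bij_betw_graph_perfect_matchings[of id A A F]] by simp

lemma card_perfect_matchings_full_board:
  assumes "finite A" "finite B" and full: "A \<times> B \<subseteq> F"
  shows "card (perfect_matchings F A B) = (if card A = card B then fact (card A) else 0)"
proof (cases "card A = card B")
  case True
  then obtain h where h: "bij_betw h A B" using assms finite_same_card_bij by blast
  have "(a, h (p a)) \<in> F" if "p permutes A" "a \<in> A" for p a
    using that h full by (auto simp: bij_betw_def permutes_in_image)
  then have "{p. p permutes A \<and> (\<forall>a\<in>A. (a, h (p a)) \<in> F)} = {p. p permutes A}" by blast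
  then show ?thesis
    using bij_betw_same_card[OF bij_betw_graph_perfect_matchings[OF h, of F]]
      card_permutations[OF refl \<open>finite A\<close>] True by simp
next
  case False
  then have "perfect_matchings F A B = {}"
    by (auto simp: perfect_matchings_def dest!: bij_betw_same_card)
  then show ?thesis using False by simp
qed

lemma bij_betw_Int_of_disjoint:
  assumes bij: "bij_betw f M (A \<union> C)" and M: "M \<subseteq> F \<union> G" and disj: "(f ` F \<union> A) \<inter> (f ` G \<union> C) = {}"
  shows "bij_betw f (M \<inter> F) A"
proof (rule bij_betw_subset[OF bij])
  show "f ` (M \<inter> F) = A"
  proof (intro equalityI subsetI)
    fix a assume "a \<in> f ` (M \<inter> F)"
    then show "a \<in> A" using bij disj by (auto simp: bij_betw_def)
  next
    fix a assume a: "a \<in> A"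
    then have "a \<in> f ` M" using bij by (simp add: bij_betw_def)
    then show "a \<in> f ` (M \<inter> F)" using M disj a by blast
  qed
qed simp

lemma perfect_matchings_Int_board:
  assumes "M \<in> perfect_matchings (F \<union> G) (A \<union> C) (B \<union> D)"
    and "(fst ` F \<union> A) \<inter> (fst ` G \<union> C) = {}" "(snd ` F \<union> B) \<inter> (snd ` G \<union> D) = {}"
  shows "M \<inter> F \<in> perfect_matchings F A B"
  using assms unfolding perfect_matchings_def by (blast intro: bij_betw_Int_of_disjoint)

lemma card_perfect_matchings_disjoint_boards:
  assumes rows: "(fst ` F \<union> A) \<inter> (fst ` G \<union> C) = {}" and cols: "(snd ` F \<union> B) \<inter> (snd ` G \<union> D) = {}"
  shows "card (perfect_matchings (F \<union> G) (A \<union> C) (B \<union> D)) =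
    card (perfect_matchings F A B) * card (perfect_matchings G C D)"
proof -
  let ?P = "perfect_matchings (F \<union> G) (A \<union> C) (B \<union> D)"
  have disj: "F \<inter> G = {}" "A \<inter> C = {}" "B \<inter> D = {}" using rows cols by auto
  have union: "M \<union> N \<in> ?P" and union_Int: "(M \<union> N) \<inter> F = M" "(M \<union> N) \<inter> G = N"
    if MN: "M \<in> perfect_matchings F A B" "N \<in> perfect_matchings G C D" for M N
  proof -
    show "M \<union> N \<in> ?P" using MN disj by (intro perfect_matchings_Un)
    have "M \<subseteq> F" "N \<subseteq> G" using MN by (simp_all add: perfect_matchings_def)
    then show "(M \<union> N) \<inter> F = M" "(M \<union> N) \<inter> G = N" using disj by blast+
  qed
  have restrict: "M \<inter> F \<in> perfect_matchings F A B" "M \<inter> G \<in> perfect_matchings G C D"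
    and Int_union: "M \<inter> F \<union> M \<inter> G = M" if M: "M \<in> ?P" for M
  proof -
    show "M \<inter> F \<in> perfect_matchings F A B"
      using M rows cols by (rule perfect_matchings_Int_board)
    show "M \<inter> G \<in> perfect_matchings G C D"
      by (rule perfect_matchings_Int_board[of M G F C A D B])
        (use M rows cols in \<open>simp_all only: Un_commute Int_commute\<close>)
    show "M \<inter> F \<union> M \<inter> G = M" using M by (auto simp: perfect_matchings_def)
  qed
  have "bij_betw (\<lambda>(M, N). M \<union> N) (perfect_matchings F A B \<times> perfect_matchings G C D) ?P"
    by (rule bij_betw_byWitness[where f' = "\<lambda>M. (M \<inter> F, M \<inter> G)"])
      (auto simp: union union_Int restrict Int_union)
  then show ?thesis by (simp add: bij_betw_same_card[symmetric] card_cartesian_product)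
qed

lemma bij_betw_Diff_image:
  assumes "bij_betw f M A"
  shows "bij_betw f (M - X) (A - f ` (M \<inter> X))"
proof -
  have "bij_betw f (M - M \<inter> X) (A - f ` (M \<inter> X))"
    using assms by (intro bij_betw_DiffI) (auto simp: bij_betw_def intro: inj_on_subset)
  then show ?thesis by (simp add: Diff_Int)
qed

lemma perfect_matchings_Diff_board:
  "M \<in> perfect_matchings (X \<union> F) A B \<Longrightarrow>
     M - X \<in> perfect_matchings F (A - fst ` (M \<inter> X)) (B - snd ` (M \<inter> X))"
  by (auto simp: perfect_matchings_def bij_betw_Diff_image)

lemma card_perfect_matchings_Un:
  assumes disj: "X \<inter> F = {}" and X: "X \<subseteq> A \<times> B" and fin: "finite A" "finite B"
  shows "card (perfect_matchings (X \<union> F) A B) =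
    (\<Sum>N\<in>rook_placements X. card (perfect_matchings F (A - fst ` N) (B - snd ` N)))"
proof -
  let ?P = "perfect_matchings (X \<union> F) A B"
  let ?Q = "\<lambda>N. perfect_matchings F (A - fst ` N) (B - snd ` N)"
  have union: "N \<union> M \<in> ?P" and union_Int: "(N \<union> M) \<inter> X = N" "(N \<union> M) - X = M"
    if N: "N \<in> rook_placements X" and M: "M \<in> ?Q N" for N M
  proof -
    have lines: "fst ` N \<subseteq> A" "snd ` N \<subseteq> B" using N X by (auto simp: rook_placements_def)
    have "N \<in> perfect_matchings X (fst ` N) (snd ` N)"
      using N by (simp add: rook_placements_def perfect_matchings_def bij_betw_def)
    from perfect_matchings_Un[OF this M] show "N \<union> M \<in> ?P"
      using lines by (simp add: Un_absorb1)
    have "N \<subseteq> X" "M \<subseteq> F" using N M by (simp_all add: rook_placements_def perfect_matchings_def)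
    then show "(N \<union> M) \<inter> X = N" "(N \<union> M) - X = M" using disj by blast+
  qed
  have restrict: "M \<inter> X \<in> rook_placements X" "M - X \<in> ?Q (M \<inter> X)" if M: "M \<in> ?P" for M
  proof -
    show "M \<inter> X \<in> rook_placements X"
      using M by (auto simp: rook_placements_def perfect_matchings_def bij_betw_def
          intro: inj_on_subset)
    show "M - X \<in> ?Q (M \<inter> X)" using M by (rule perfect_matchings_Diff_board)
  qed
  have "bij_betw (\<lambda>(N, M). N \<union> M) (Sigma (rook_placements X) ?Q) ?P"
    by (rule bij_betw_byWitness[where f' = "\<lambda>M. (M \<inter> X, M - X)"])
      (auto simp: union union_Int restrict)
  then have "card ?P = card (Sigma (rook_placements X) ?Q)"
    by (simp add: bij_betw_same_card)
  also have "finite X" using X fin by (meson finite_SigmaI finite_subset)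
  then have "card (Sigma (rook_placements X) ?Q) = (\<Sum>N\<in>rook_placements X. card (?Q N))"
    using fin by (simp add: card_SigmaI finite_rook_placements finite_perfect_matchings)
  finally show ?thesis .
qed

lemma card_perfect_matchings_diagonal_blocks:
  assumes "T \<inter> B = {}" "L \<inter> R = {}" "finite T" "finite B" "finite L" "finite R"
    and "T' \<subseteq> T" "B' \<subseteq> B" "L' \<subseteq> L" "R' \<subseteq> R"
  shows "card (perfect_matchings (T \<times> L \<union> B \<times> R) (T' \<union> B') (L' \<union> R')) =
    (if card T' = card L' \<and> card B' = card R' then fact (card T') * fact (card B') else 0)"
proof -
  have "card (perfect_matchings (T \<times> L \<union> B \<times> R) (T' \<union> B') (L' \<union> R')) =
      card (perfect_matchings (T \<times> L) T' L') * card (perfect_matchings (B \<times> R) B' R')"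
    using assms by (intro card_perfect_matchings_disjoint_boards) auto
  moreover have "card (perfect_matchings (T \<times> L) T' L') =
      (if card T' = card L' then fact (card T') else 0)"
    using assms by (intro card_perfect_matchings_full_board) (auto intro: finite_subset)
  moreover have "card (perfect_matchings (B \<times> R) B' R') =
      (if card B' = card R' then fact (card B') else 0)"
    using assms by (intro card_perfect_matchings_full_board) (auto intro: finite_subset)
  ultimately show ?thesis by simp
qed

context
  fixes T B :: "'a set" and L R :: "'b set" and X Y :: "('a \<times> 'b) set" and k m :: nat
  assumes disj: "T \<inter> B = {}" "L \<inter> R = {}"
    and fin: "finite T" "finite B" "finite L" "finite R"
    and cards: "card T = k" "card R = k" "card B = m" "card L = m"
    and X: "X \<subseteq> T \<times> R" and Y: "Y \<subseteq> B \<times> L"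
begin

lemma card_completions_of_off_diagonal_placements:
  assumes M: "M \<in> rook_placements X" and N: "N \<in> rook_placements Y"
  shows "card (perfect_matchings (T \<times> L \<union> B \<times> R)
      (T \<union> B - fst ` M - fst ` N) (L \<union> R - snd ` M - snd ` N)) =
    (if k - card M = m - card N then (fact (k - card M))\<^sup>2 else 0)"
proof -
  have lines: "fst ` X \<subseteq> T" "snd ` X \<subseteq> R" "fst ` Y \<subseteq> B" "snd ` Y \<subseteq> L" using X Y by auto
  have "fst ` M \<subseteq> T" "snd ` M \<subseteq> R" "fst ` N \<subseteq> B" "snd ` N \<subseteq> L"
    using M N X Y by (auto simp: rook_placements_def)
  then have "T \<union> B - fst ` M - fst ` N = (T - fst ` M) \<union> (B - fst ` N)"
    "L \<union> R - snd ` M - snd ` N = (L - snd ` N) \<union> (R - snd ` M)"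
    using disj by blast+
  then show ?thesis
    using card_perfect_matchings_diagonal_blocks[OF disj fin,
        of "T - fst ` M" "B - fst ` N" "L - snd ` N" "R - snd ` M"]
      card_Diff_fst_rook_placement[OF M lines(1)] card_Diff_snd_rook_placement[OF M lines(2)]
      card_Diff_fst_rook_placement[OF N lines(3)] card_Diff_snd_rook_placement[OF N lines(4)]
    by (auto simp: fin cards power2_eq_square)
qed

lemma card_perfect_matchings_blocks:
  "card (perfect_matchings (X \<union> (Y \<union> (T \<times> L \<union> B \<times> R))) (T \<union> B) (L \<union> R)) =
     (\<Sum>i\<le>min k m. rook_number X (k - i) * rook_number Y (m - i) * (fact i)\<^sup>2)"
proof -
  let ?D = "T \<times> L \<union> B \<times> R"
  let ?completions = "\<lambda>F M. perfect_matchings F (T \<union> B - fst ` M) (L \<union> R - snd ` M)"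
  have finite_XY: "finite X" "finite Y" using X Y fin by (meson finite_SigmaI finite_subset)+
  have fst_XY: "fst ` X \<subseteq> T" "fst ` Y \<subseteq> B" using X Y by auto
  have "card (perfect_matchings (X \<union> (Y \<union> ?D)) (T \<union> B) (L \<union> R)) =
      (\<Sum>M\<in>rook_placements X. card (?completions (Y \<union> ?D) M))"
    using X Y disj fin by (intro card_perfect_matchings_Un) auto
  also have "\<dots> = (\<Sum>M\<in>rook_placements X. \<Sum>N\<in>rook_placements Y.
      if k - card M = m - card N then (fact (k - card M))\<^sup>2 else 0)"
  proof (rule sum.cong)
    fix M assume M: "M \<in> rook_placements X"
    then have "fst ` M \<subseteq> T" "snd ` M \<subseteq> R" using X by (auto simp: rook_placements_def)
    then have "Y \<subseteq> (T \<union> B - fst ` M) \<times> (L \<union> R - snd ` M)"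
      using Y disj by fast
    moreover have "Y \<inter> ?D = {}" using Y disj by auto
    ultimately have "card (?completions (Y \<union> ?D) M) = (\<Sum>N\<in>rook_placements Y.
        card (perfect_matchings ?D (T \<union> B - fst ` M - fst ` N) (L \<union> R - snd ` M - snd ` N)))"
      using fin by (intro card_perfect_matchings_Un) auto
    then show "card (?completions (Y \<union> ?D) M) =
        (\<Sum>N\<in>rook_placements Y. if k - card M = m - card N then (fact (k - card M))\<^sup>2 else 0)"
      by (simp add: M card_completions_of_off_diagonal_placements)
  qed simp
  also have "\<dots> = (\<Sum>i\<le>min k m. rook_number X (k - i) * rook_number Y (m - i) * (fact i)\<^sup>2)"
    using finite_XY card_rook_placement_le[OF _ fst_XY(1)] card_rook_placement_le[OF _ fst_XY(2)]
    by (intro sum_rook_placements_equal_diff_card) (simp_all add: fin cards)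
  finally show ?thesis .
qed

end

subsection \<open>Band permutations\<close>

definition band_permutations :: "nat \<Rightarrow> nat \<Rightarrow> (nat \<Rightarrow> nat) set" where
  "band_permutations n k = {u. u permutes {1..n} \<and> (\<forall>i\<in>{1..n}. i \<le> u i + k \<and> u i + k \<le> i + n)}"

lemma band_board_blocks:
  "{(i, j). i \<le> j + k \<and> j + k \<le> i + (m + k)} \<inter> {1..m + k} \<times> {1..m + k} =
     staircase m k \<union> ((staircase k m)\<inverse> \<union> ({1..k} \<times> {1..m} \<union> {k<..m + k} \<times> {m<..m + k}))"
  by (auto simp: staircase_def)

lemma card_band_permutations:
  assumes "k \<le> n"
  shows "card (band_permutations n k) =
    (\<Sum>i = 0..k. Stirling (k + 1) (i + 1) * Stirling (n - k + 1) (i + 1) * (fact i)\<^sup>2)"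
proof -
  define m where "m = n - k"
  let ?F = "{(i, j). i \<le> j + k \<and> j + k \<le> i + n}"
  have n_eq: "n = m + k" using assms by (simp add: m_def)
  have rows: "{1..n} = {1..k} \<union> {k<..n}" and cols: "{1..n} = {1..m} \<union> {m<..n}" using n_eq by auto
  have "card (band_permutations n k) =
      card (perfect_matchings (?F \<inter> {1..n} \<times> {1..n}) {1..n} {1..n})"
    using card_permutations_in_board[of "{1..n}" ?F]
    by (simp add: band_permutations_def perfect_matchings_Int)
  also have "\<dots> = card (perfect_matchings
      (staircase m k \<union> ((staircase k m)\<inverse> \<union> ({1..k} \<times> {1..m} \<union> {k<..n} \<times> {m<..n})))
      ({1..k} \<union> {k<..n}) ({1..m} \<union> {m<..n}))"
    using band_board_blocks[of k m] rows cols n_eq by simp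
  also have "\<dots> = (\<Sum>i\<le>min k m. rook_number (staircase m k) (k - i) *
      rook_number ((staircase k m)\<inverse>) (m - i) * (fact i)\<^sup>2)"
    by (rule card_perfect_matchings_blocks) (auto simp: staircase_def n_eq)
  also have "\<dots> = (\<Sum>i\<le>min k m. Stirling (k + 1) (i + 1) * Stirling (m + 1) (i + 1) * (fact i)\<^sup>2)"
    by (intro sum.cong) (simp_all add: rook_number_converse rook_number_staircase Suc_diff_le)
  also have "\<dots> = (\<Sum>i = 0..k. Stirling (k + 1) (i + 1) * Stirling (m + 1) (i + 1) * (fact i)\<^sup>2)"
    by (rule sum.mono_neutral_left) auto
  finally show ?thesis by (simp only: m_def)
qed

subsection \<open>Bruhat order\<close>

definition inversions :: "nat \<Rightarrow> (nat \<Rightarrow> nat) \<Rightarrow> (nat \<times> nat) set" where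
  "inversions n u = {(i, j). 1 \<le> i \<and> i < j \<and> j \<le> n \<and> u j < u i}"

lemma finite_inversions: "finite (inversions n u)"
  by (rule finite_subset[of _ "{1..n} \<times> {1..n}"]) (auto simp: inversions_def)

lemma perm_length_eq_card_inversions: "perm_length n u = card (inversions n u)"
  by (simp add: perm_length_def inversions_def)

lemma perm_length_le: "perm_length n u \<le> n * n"
proof -
  have "card (inversions n u) \<le> card ({1..n} \<times> {1..n})"
    by (rule card_mono) (auto simp: inversions_def)
  then show ?thesis by (simp add: perm_length_eq_card_inversions)
qed

lemma perm_length_less_comp_transpose:
  assumes ab: "1 \<le> a" "a < b" "b \<le> n" and less: "u a < u b"
  shows "perm_length n u < perm_length n (u \<circ> transpose a b)"
proof -
  let ?t = "transpose a b"
  let ?f = "\<lambda>(i, j). if ?t i < ?t j then (?t i, ?t j) else (i, j)"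
  have t_range: "?t i \<in> {1..n} \<longleftrightarrow> i \<in> {1..n}" for i
    using ab by (intro permutes_in_image permutes_swap_id) auto
  have "?f (i, j) \<in> inversions n (u \<circ> ?t) - {(a, b)}" if ij: "(i, j) \<in> inversions n u" for i j
  proof (cases "?t i < ?t j")
    case True
    have "(?t i, ?t j) \<noteq> (a, b)"
      using ij ab by (auto simp: transpose_eq_iff inversions_def)
    then show ?thesis using True ij t_range[of i] t_range[of j] by (simp add: inversions_def)
  next
    case False
    then show ?thesis
      using ij ab less by (auto simp: inversions_def transpose_def split: if_splits)
  qed
  then have "?f ` inversions n u \<subseteq> inversions n (u \<circ> ?t) - {(a, b)}"
    by (intro image_subsetI) (simp only: split_paired_all)
  moreover have "inj_on ?f (inversions n u)"
  proof (rule inj_onI)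
    fix x y assume "x \<in> inversions n u" "y \<in> inversions n u" and eq: "?f x = ?f y"
    then obtain i j i' j' where "x = (i, j)" "y = (i', j')" "i < j" "i' < j'"
      by (auto simp: inversions_def)
    then show "x = y"
      using eq by (cases "?t i < ?t j"; cases "?t i' < ?t j'") (auto simp: transpose_eq_iff)
  qed
  ultimately have "perm_length n u \<le> card (inversions n (u \<circ> ?t) - {(a, b)})"
    unfolding perm_length_eq_card_inversions by (intro card_inj_on_le finite_Diff finite_inversions)
  also have "(a, b) \<in> inversions n (u \<circ> ?t)" using ab less by (simp add: inversions_def)
  then have "card (inversions n (u \<circ> ?t) - {(a, b)}) < perm_length n (u \<circ> ?t)"
    unfolding perm_length_eq_card_inversions by (intro card_Diff1_less finite_inversions)
  finally show ?thesis .
qed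

lemma perm_length_less_comp_transpose_iff:
  assumes ab: "1 \<le> a" "a < b" "b \<le> n" and "u a \<noteq> u b"
  shows "perm_length n u < perm_length n (u \<circ> transpose a b) \<longleftrightarrow> u a < u b"
proof (rule iffI, rule ccontr)
  assume "\<not> u a < u b"
  then have "(u \<circ> transpose a b) a < (u \<circ> transpose a b) b" using \<open>u a \<noteq> u b\<close> by simp
  from perm_length_less_comp_transpose[OF ab this]
  have "perm_length n (u \<circ> transpose a b) < perm_length n u"
    by (simp only: comp_assoc transpose_comp_involutory comp_id)
  moreover assume "perm_length n u < perm_length n (u \<circ> transpose a b)"
  ultimately show False by simp
qed (rule perm_length_less_comp_transpose[OF ab])

lemma permutes_comp_transpose:
  "u permutes S \<Longrightarrow> a \<in> S \<Longrightarrow> b \<in> S \<Longrightarrow> u \<circ> transpose a b permutes S"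
  by (intro permutes_compose permutes_swap_id)

lemma bruhat_step_iff:
  "bruhat_step n u v \<longleftrightarrow>
     u permutes {1..n} \<and> (\<exists>a b. 1 \<le> a \<and> a < b \<and> b \<le> n \<and> u a < u b \<and> v = u \<circ> transpose a b)"
proof (cases "u permutes {1..n}")
  case True
  then have "u a \<noteq> u b" if "a < b" for a b
    using that by (metis permutes_inj injD less_irrefl)
  then show ?thesis
    using perm_length_less_comp_transpose_iff True
    unfolding bruhat_step_def sym_group_carrier sym_group_mult by blast
qed (simp add: bruhat_step_def sym_group_carrier)

text \<open>If there were no crossing, \<open>p\<close> would permute the points of \<open>S\<close> in \<open>(a, p a]\<close> for the largest
  excedance \<open>a\<close>, and no point outside, such as \<open>a\<close>, could be mapped to \<open>p a\<close>.\<close>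

lemma permutes_ex_crossing:
  fixes p :: "'a :: wellorder \<Rightarrow> 'a"
  assumes p: "p permutes S" and "finite S" and "p \<noteq> id"
  shows "\<exists>a\<in>S. \<exists>b\<in>S. a < b \<and> p b \<le> a \<and> b \<le> p a"
proof (rule ccontr)
  assume no_crossing: "\<not> ?thesis"
  define a where "a = Max {i \<in> S. i < p i}"
  have "{i \<in> S. i < p i} \<noteq> {}"
    using permutes_natset_le[OF p] \<open>p \<noteq> id\<close> by (auto simp: not_less)
  then have "a \<in> {i \<in> S. i < p i}"
    unfolding a_def using \<open>finite S\<close> by (intro Max_in) simp
  then have a_excedance: "a \<in> S" "a < p a" by auto
  let ?I = "{b \<in> S. a < b \<and> b \<le> p a}"
  have "p b \<le> b" if "b \<in> S" "a < b" for b
  proof (rule ccontr)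
    assume "\<not> p b \<le> b"
    then have "b \<le> a" unfolding a_def using \<open>b \<in> S\<close> \<open>finite S\<close> by (intro Max_ge) auto
    then show False using \<open>a < b\<close> by simp
  qed
  then have "p ` ?I \<subseteq> ?I"
    using no_crossing a_excedance p by (force simp: permutes_in_image not_le)
  then have "p ` ?I = ?I"
    using \<open>finite S\<close> p by (intro endo_inj_surj) (auto intro: permutes_inj_on)
  moreover have "p a \<in> ?I" using a_excedance p by (simp add: permutes_in_image)
  ultimately have "p a \<in> p ` ?I" by simp
  then have "a \<in> ?I" by (simp only: inj_image_mem_iff[OF permutes_inj[OF p]])
  then show False by simp
qed

lemma bruhat_le_id:
  assumes "x permutes {1..n}"
  shows "bruhat_le n id x"
  using assms
proof (induction "perm_length n x" arbitrary: x rule: less_induct)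
  case less
  show ?case
  proof (cases "x = id")
    case True
    then show ?thesis by (simp add: bruhat_le_def)
  next
    case False
    then obtain a b where ab: "a \<in> {1..n}" "b \<in> {1..n}" "a < b" "x b < x a"
      using permutes_ex_crossing[OF less.prems] by fastforce
    let ?y = "x \<circ> transpose a b"
    have y: "?y permutes {1..n}" using less.prems ab by (intro permutes_comp_transpose)
    have "x = ?y \<circ> transpose a b" by (simp add: comp_assoc)
    then have "bruhat_step n ?y x"
      unfolding bruhat_step_iff using y ab by (intro conjI exI[of _ a] exI[of _ b]) simp_all
    moreover from this have "bruhat_le n id ?y"
      by (intro less.hyps y) (simp add: bruhat_step_def)
    ultimately show ?thesis unfolding bruhat_le_def by (rule rtranclp.rtrancl_into_rtrancl[rotated])
  qed
qed

lemma band_permutations_step_down_closed: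
  assumes "bruhat_step n u v" and v: "v \<in> band_permutations n k"
  shows "u \<in> band_permutations n k"
proof -
  obtain a b where u: "u permutes {1..n}" and ab: "1 \<le> a" "a < b" "b \<le> n" "u a < u b"
    and v_eq: "v = u \<circ> transpose a b"
    using assms(1) by (auto simp: bruhat_step_iff)
  have band: "i \<le> v i + k" "v i + k \<le> i + n" if "i \<in> {1..n}" for i
    using v that by (auto simp: band_permutations_def)
  have "i \<le> u i + k \<and> u i + k \<le> i + n" if i: "i \<in> {1..n}" for i
    using band[of i] band[of a] band[of b] ab i
    by (cases "i = a"; cases "i = b") (auto simp: v_eq)
  then show ?thesis using u by (simp add: band_permutations_def)
qed

lemma band_permutations_down_closed:
  assumes "bruhat_le n u v" "v \<in> band_permutations n k"
  shows "u \<in> band_permutations n k"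
  using assms unfolding bruhat_le_def
  by (induction rule: converse_rtranclp_induct) (auto intro: band_permutations_step_down_closed)

subsection \<open>Minimal coset representatives of a maximal parabolic subgroup\<close>

lemma setwise_stabilizer_subgroup:
  "subgroup {p. p permutes {1..n} \<and> p ` A = A} (sym_group n)" (is "subgroup ?H _")
proof (rule group.subgroupI[OF sym_group_is_group])
  show "?H \<subseteq> carrier (sym_group n)" by (auto simp: sym_group_carrier)
  have "id \<in> ?H" by simp
  then show "?H \<noteq> {}" by blast
next
  fix p assume p: "p \<in> ?H"
  then have "inv' p ` A = A" by (metis (mono_tags) image_inv_f_f mem_Collect_eq permutes_inj)
  then show "inv\<^bsub>sym_group n\<^esub> p \<in> ?H"
    using p by (simp add: sym_group_carrier permutes_inv)
next
  fix p q assume "p \<in> ?H" "q \<in> ?H"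
  then show "p \<otimes>\<^bsub>sym_group n\<^esub> q \<in> ?H"
    by (auto simp only: sym_group_mult mem_Collect_eq image_comp[symmetric] intro: permutes_compose)
qed

lemma parabolic_subset_stabilizer:
  "parabolic n ({1..n - 1} - {k}) \<subseteq> {p. p permutes {1..n} \<and> p ` {1..k} = {1..k}}"
  unfolding parabolic_def
proof (rule group.generate_subgroup_incl[OF sym_group_is_group _ setwise_stabilizer_subgroup],
    clarify)
  fix i assume "i \<in> {1..n - 1}" "i \<noteq> k"
  then have "adj_transp i permutes {1..n}"
    unfolding adj_transp_def by (intro permutes_swap_id) auto
  moreover have "i \<in> {1..k} \<longleftrightarrow> i + 1 \<in> {1..k}"
    using \<open>i \<in> {1..n - 1}\<close> \<open>i \<noteq> k\<close> by auto
  ultimately show "adj_transp i permutes {1..n} \<and> adj_transp i ` {1..k} = {1..k}"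
    by (simp only: adj_transp_def transpose_image_eq)
qed

lemma min_left_coset_reps_ascent:
  assumes v: "v \<in> min_left_coset_reps n J" and i: "i \<in> J" "1 \<le> i" "i < n"
  shows "v i < v (Suc i)"
proof (rule ccontr)
  assume not_ascent: "\<not> v i < v (Suc i)"
  let ?u = "v \<circ> transpose i (Suc i)"
  have "adj_transp i \<in> parabolic n J"
    unfolding parabolic_def using i by (intro generate.incl imageI)
  then have "perm_length n v \<le> perm_length n ?u"
    using v by (auto simp: min_left_coset_reps_def l_coset_def sym_group_mult adj_transp_def)
  moreover have "v permutes {1..n}"
    using v by (simp add: min_left_coset_reps_def sym_group_carrier)
  then have "v i \<noteq> v (Suc i)" by (metis permutes_inj injD n_not_Suc_n)
  then have "perm_length n ?u < perm_length n (?u \<circ> transpose i (Suc i))"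
    using not_ascent i by (intro perm_length_less_comp_transpose) auto
  ultimately show False by (simp add: comp_assoc)
qed

lemma strict_mono_on_intervalI:
  fixes f :: "nat \<Rightarrow> 'a :: order"
  assumes "\<And>i. a \<le> i \<Longrightarrow> i < b \<Longrightarrow> f i < f (Suc i)"
  shows "strict_mono_on {a..b} f"
proof (rule strict_mono_onI)
  fix i j assume "i \<in> {a..b}" "j \<in> {a..b}" "i < j"
  then show "f i < f j"
    using assms lift_Suc_mono_less_ivl[of "{a..<b}" f i j] by auto
qed

lemma perm_length_le_comp_block_permutation:
  assumes "k \<le> n" and mono: "strict_mono_on {1..k} v" "strict_mono_on {k<..n} v"
    and p: "p permutes {1..n}" "p ` {1..k} = {1..k}"
  shows "perm_length n v \<le> perm_length n (v \<circ> p)"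
proof -
  have inversion_blocks: "i \<in> {1..k} \<and> j \<in> {k<..n}" if ij: "(i, j) \<in> inversions n v" for i j
  proof (rule ccontr)
    assume "\<not> ?thesis"
    then have "{i, j} \<subseteq> {1..k} \<or> {i, j} \<subseteq> {k<..n}" using ij by (auto simp: inversions_def)
    then have "v i < v j"
      using strict_mono_onD[OF mono(1), of i j] strict_mono_onD[OF mono(2), of i j] ij
      by (auto simp: inversions_def)
    then show False using ij by (simp add: inversions_def)
  qed
  define q where "q = inv' p"
  have q: "q permutes {1..n}" and p_q: "p (q i) = i" for i
    using p(1) by (simp_all add: q_def permutes_inv permutes_inverses)
  have "inj q" using q by (rule permutes_inj)
  have q_image: "q ` {1..k} = {1..k}"
    unfolding q_def using p by (metis image_inv_f_f permutes_inj)
  have q_block: "q i \<in> {1..k} \<longleftrightarrow> i \<in> {1..k}" for i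
    using inj_image_mem_iff[OF \<open>inj q\<close>, of i "{1..k}"] by (simp only: q_image)
  have q_range: "q i \<in> {1..n} \<longleftrightarrow> i \<in> {1..n}" for i using q by (rule permutes_in_image)
  have "map_prod q q ` inversions n v \<subseteq> inversions n (v \<circ> p)"
  proof (intro image_subsetI, clarify)
    fix i j assume ij: "(i, j) \<in> inversions n v"
    then show "map_prod q q (i, j) \<in> inversions n (v \<circ> p)"
      using inversion_blocks[OF ij] q_block[of i] q_block[of j] q_range[of j] \<open>k \<le> n\<close>
      by (auto simp: inversions_def p_q)
  qed
  then show ?thesis
    unfolding perm_length_eq_card_inversions
    using inj_on_subset[OF prod.inj_map[OF \<open>inj q\<close> \<open>inj q\<close>] subset_UNIV]
    by (intro card_inj_on_le[of "map_prod q q"] finite_inversions)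
qed

lemma min_left_coset_reps_maximal_parabolic_iff:
  assumes "k \<le> n"
  shows "v \<in> min_left_coset_reps n ({1..n - 1} - {k}) \<longleftrightarrow>
    v permutes {1..n} \<and> strict_mono_on {1..k} v \<and> strict_mono_on {k<..n} v"
proof (intro iffI conjI; (elim conjE)?)
  assume v: "v \<in> min_left_coset_reps n ({1..n - 1} - {k})"
  show "v permutes {1..n}" using v by (simp add: min_left_coset_reps_def sym_group_carrier)
  show "strict_mono_on {1..k} v"
    using assms by (intro strict_mono_on_intervalI min_left_coset_reps_ascent[OF v]) auto
  have "strict_mono_on {Suc k..n} v"
    by (intro strict_mono_on_intervalI min_left_coset_reps_ascent[OF v]) auto
  then show "strict_mono_on {k<..n} v" by (simp only: atLeastSucAtMost_greaterThanAtMost)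
next
  assume v: "v permutes {1..n}" and mono: "strict_mono_on {1..k} v" "strict_mono_on {k<..n} v"
  have "perm_length n v \<le> perm_length n (v \<circ> p)"
    if "p \<in> parabolic n ({1..n - 1} - {k})" for p
    using subsetD[OF parabolic_subset_stabilizer that]
      perm_length_le_comp_block_permutation[OF assms mono]
    by blast
  then show "v \<in> min_left_coset_reps n ({1..n - 1} - {k})"
    using v by (auto simp: min_left_coset_reps_def l_coset_def sym_group_mult sym_group_carrier)
qed

lemma strict_mono_on_blocks_imp_band_permutation:
  assumes "k \<le> n" and v: "v permutes {1..n}"
    and mono: "strict_mono_on {1..k} v" "strict_mono_on {k<..n} v"
  shows "v \<in> band_permutations n k"
proof -
  have "i \<le> v i + k \<and> v i + k \<le> i + n" if i: "i \<in> {1..n}" for i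
  proof (cases "i \<le> k")
    case True
    have "v ` {i..k} \<subseteq> {v i..n}"
    proof clarify
      fix j assume j: "j \<in> {i..k}"
      then have "v i \<le> v j"
        using strict_mono_onD[OF mono(1), of i j] i True by (cases "i = j") auto
      then show "v j \<in> {v i..n}" using permutes_in_image[OF v, of j] i j \<open>k \<le> n\<close> by auto
    qed
    then have "card {i..k} \<le> card {v i..n}"
      by (rule card_inj_on_le[OF permutes_inj_on[OF v]]) simp
    then show ?thesis using True permutes_in_image[OF v, of i] i by auto
  next
    case False
    have "v ` {k<..i} \<subseteq> {1..v i}"
    proof clarify
      fix j assume j: "j \<in> {k<..i}"
      then have "v j \<le> v i"
        using strict_mono_onD[OF mono(2), of j i] i False by (cases "i = j") auto
      then show "v j \<in> {1..v i}" using permutes_in_image[OF v, of j] i j by auto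
    qed
    then have "card {k<..i} \<le> card {1..v i}"
      by (rule card_inj_on_le[OF permutes_inj_on[OF v]]) simp
    then show ?thesis using False permutes_in_image[OF v, of i] i by auto
  qed
  then show ?thesis using v by (simp add: band_permutations_def)
qed

subsection \<open>The interval below the top Grassmannian permutation\<close>

locale top_grassmannian =
  fixes n k :: nat and w :: "nat \<Rightarrow> nat"
  assumes k_le_n: "k \<le> n" and w_permutes: "w permutes {1..n}"
    and w_low: "\<And>i. 1 \<le> i \<Longrightarrow> i \<le> k \<Longrightarrow> w i = n - k + i"
    and w_high: "\<And>i. k + 1 \<le> i \<Longrightarrow> i \<le> n \<Longrightarrow> w i = i - k"
begin

lemma w_in_min_left_coset_reps: "w \<in> min_left_coset_reps n ({1..n - 1} - {k})"
  unfolding min_left_coset_reps_maximal_parabolic_iff[OF k_le_n]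
  using w_permutes by (auto simp: w_low w_high intro!: strict_mono_onI)

lemma min_left_coset_reps_subset_band:
  "min_left_coset_reps n ({1..n - 1} - {k}) \<subseteq> band_permutations n k"
  using strict_mono_on_blocks_imp_band_permutation[OF k_le_n]
  unfolding min_left_coset_reps_maximal_parabolic_iff[OF k_le_n] subset_iff by blast

lemma w_in_band: "w \<in> band_permutations n k"
  using w_in_min_left_coset_reps min_left_coset_reps_subset_band by blast

lemma inv_w:
  assumes "j \<in> {1..n}"
  shows "inv' w j = (if j \<le> n - k then j + k else j + k - n)"
  unfolding permutes_inv_eq[OF w_permutes] using assms k_le_n w_low w_high by auto

text \<open>In terms of \<open>p = w\<inverse> \<circ> u\<close> the band condition reads \<open>i \<le> p i\<close> if \<open>u i \<le> n - k\<close>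
  and \<open>p i \<le> i\<close> otherwise, so any crossing of \<open>p\<close> can be swapped.\<close>

lemma band_permutations_ex_step_up:
  assumes u: "u \<in> band_permutations n k" and "u \<noteq> w"
  shows "\<exists>v. bruhat_step n u v \<and> v \<in> band_permutations n k"
proof -
  have perm: "u permutes {1..n}" using u by (simp add: band_permutations_def)
  have band: "i \<le> u i + k" "u i + k \<le> i + n" if "i \<in> {1..n}" for i
    using u that by (auto simp: band_permutations_def)
  let ?p = "inv' w \<circ> u"
  have p_eq: "?p i = (if u i \<le> n - k then u i + k else u i + k - n)" if "i \<in> {1..n}" for i
    using inv_w[of "u i"] that permutes_in_image[OF perm, of i] by simp
  have "?p permutes {1..n}" using perm w_permutes by (intro permutes_compose permutes_inv)
  moreover have "?p \<noteq> id"
  proof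
    assume "?p = id"
    then have "w \<circ> ?p = w" by simp
    then show False using \<open>u \<noteq> w\<close> w_permutes by (simp add: comp_assoc[symmetric] permutes_inv_o)
  qed
  ultimately obtain a b where ab: "a \<in> {1..n}" "b \<in> {1..n}" "a < b" "?p b \<le> a" "b \<le> ?p a"
    using permutes_ex_crossing by blast
  have a_small: "u a \<le> n - k" "b \<le> u a + k"
    using ab p_eq[of a] band[of a] by (auto split: if_splits)
  have b_large: "n - k < u b" "u b + k \<le> a + n"
    using ab p_eq[of b] band[of b] by (auto split: if_splits)
  let ?v = "u \<circ> transpose a b"
  have "bruhat_step n u ?v"
    unfolding bruhat_step_iff using perm ab a_small b_large
    by (intro conjI exI[of _ a] exI[of _ b]) auto
  moreover have "i \<le> ?v i + k \<and> ?v i + k \<le> i + n" if i: "i \<in> {1..n}" for i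
    using band[OF i] band[OF ab(1)] band[OF ab(2)] ab(3) a_small b_large
    by (cases "i = a"; cases "i = b") auto
  then have "?v \<in> band_permutations n k"
    using perm ab by (simp add: band_permutations_def permutes_comp_transpose)
  ultimately show ?thesis by blast
qed

lemma band_permutations_bruhat_le_w:
  assumes "u \<in> band_permutations n k"
  shows "bruhat_le n u w"
  using assms
proof (induction "n * n - perm_length n u" arbitrary: u rule: less_induct)
  case less
  show ?case
  proof (cases "u = w")
    case True
    then show ?thesis by (simp add: bruhat_le_def)
  next
    case False
    then obtain v where v: "bruhat_step n u v" "v \<in> band_permutations n k"
      using band_permutations_ex_step_up less.prems by blast
    then have "perm_length n u < perm_length n v" by (simp add: bruhat_step_def)
    then have "bruhat_le n v w"
      using less.hyps[OF _ v(2)] perm_length_le[of n v] by simp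
    then show ?thesis using v(1) unfolding bruhat_le_def by simp
  qed
qed

lemma bruhat_interval_id_w: "bruhat_interval n id w = band_permutations n k"
proof (intro equalityI subsetI)
  fix u assume "u \<in> bruhat_interval n id w"
  then show "u \<in> band_permutations n k"
    using band_permutations_down_closed[OF _ w_in_band] by (simp add: bruhat_interval_def)
next
  fix u assume u: "u \<in> band_permutations n k"
  then have "u permutes {1..n}" by (simp add: band_permutations_def)
  then show "u \<in> bruhat_interval n id w"
    using band_permutations_bruhat_le_w[OF u] bruhat_le_id
    by (simp add: bruhat_interval_def sym_group_carrier)
qed

end

theorem theorem3p5:
  fixes n k :: nat and w :: "nat \<Rightarrow> nat"
  assumes "1 \<le> k" and "k \<le> n - 1"
    and "w \<in> carrier (sym_group n)"
    and "\<And>i. 1 \<le> i \<Longrightarrow> i \<le> k \<Longrightarrow> w i = n - k + i"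
    and "\<And>i. k + 1 \<le> i \<Longrightarrow> i \<le> n \<Longrightarrow> w i = i - k"
  shows "w \<in> min_left_coset_reps n ({1..n - 1} - {k}) \<and>
         (\<forall>v \<in> min_left_coset_reps n ({1..n - 1} - {k}). bruhat_le n v w) \<and>
         card (bruhat_interval n id w) =
           (\<Sum>i = 0..k. Stirling (k + 1) (i + 1) * Stirling (n - k + 1) (i + 1) * (fact i)\<^sup>2) \<and>
         int (card (bruhat_interval n id w)) =
           (-1) ^ k * (\<Sum>i = 0..k. (-1) ^ i * (int i + 1) ^ (n - k) * fact i * int (Stirling k i)) \<and>
         rat_of_nat (card (bruhat_interval n id w)) = poly_bernoulli (int k - int n) k"
proof -
  interpret top_grassmannian n k w
    using assms by unfold_locales (auto simp: sym_group_carrier)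
  have Stirling_formula: "card (bruhat_interval n id w) =
      (\<Sum>i = 0..k. Stirling (k + 1) (i + 1) * Stirling (n - k + 1) (i + 1) * (fact i)\<^sup>2)"
    unfolding bruhat_interval_id_w by (rule card_band_permutations[OF k_le_n])
  then have alternating_formula: "int (card (bruhat_interval n id w)) =
      (-1) ^ k * (\<Sum>i = 0..k. (-1) ^ i * (int i + 1) ^ (n - k) * fact i * int (Stirling k i))"
    by (simp only: Stirling_sum_eq_alternating_sum)
  have "poly_bernoulli (int k - int n) k = poly_bernoulli (- int (n - k)) k"
    using k_le_n by (simp add: of_nat_diff)
  also have "\<dots> = of_int (int (card (bruhat_interval n id w)))"
    unfolding alternating_formula by (rule poly_bernoulli_neg_eq)
  finally have "rat_of_nat (card (bruhat_interval n id w)) = poly_bernoulli (int k - int n) k"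
    by simp
  then show ?thesis
    using Stirling_formula alternating_formula w_in_min_left_coset_reps
      min_left_coset_reps_subset_band band_permutations_bruhat_le_w by blast
qed

end
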